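(* Let $A$ be a Banach function algebra. Every $t$-analytic set for $A$ is contained in at least one maximal (with respect to inclusion) $t$-analytic set for $A$. Moreover, the maximal $t$-analytic sets for $A$ are closed in $M(A)$.
   Context: A Banach function algebra $A$ is a commutative, unital, semisimple complex Banach algebra, regarded via the Gelfand transform as an algebra of continuous functions on its character space $M(A)$ (the compact Hausdorff space of non-zero multiplicative linear functionals on $A$ with the Gelfand, i.e. weak-$*$, topology). A set $E\subseteq M(A)$ is a $t$-analytic set for $A$ if for every $f\in A$ and every non-empty relatively open subset $U$ of $E$, $f\equiv 0$ on $U$ implies $f\equiv 0$ on $E$. "Closed" refers to the Gelfand topology. *)

theory Defs
  imports "HOL-Analysis.Analysis"
begin

definition (in comm_ring_1) ring_ideal :: "'a set \<Rightarrow> bool" where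
  "ring_ideal I \<longleftrightarrow>
     0 \<in> I \<and> (\<forall>x\<in>I. \<forall>y\<in>I. x + y \<in> I) \<and> (\<forall>x\<in>I. \<forall>a. a * x \<in> I)"

definition (in comm_ring_1) maximal_ring_ideal :: "'a set \<Rightarrow> bool" where
  "maximal_ring_ideal I \<longleftrightarrow>
     ring_ideal I \<and> I \<noteq> UNIV \<and> (\<forall>J. ring_ideal J \<longrightarrow> I \<subseteq> J \<longrightarrow> J = I \<or> J = UNIV)"

definition (in comm_ring_1) jacobson_radical :: "'a set" where
  "jacobson_radical = \<Inter> {I. maximal_ring_ideal I}"

text \<open>
  The normalisation \<open>norm 1 = 1\<close> is not imposed. In a unital algebra, ring ideals are
  automatically closed under complex scalars, so the radical of the underlying ring is the
  radical of the algebra.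
\<close>

class banach_function_algebra = banach + real_normed_algebra + comm_ring_1 +
  fixes scaleC :: "complex \<Rightarrow> 'a \<Rightarrow> 'a" (infixr \<open>*\<^sub>C\<close> 75)
  assumes scaleC_add_right: "c *\<^sub>C (x + y) = c *\<^sub>C x + c *\<^sub>C y"
    and scaleC_add_left: "(c + d) *\<^sub>C x = c *\<^sub>C x + d *\<^sub>C x"
    and scaleC_scaleC: "c *\<^sub>C (d *\<^sub>C x) = (c * d) *\<^sub>C x"
    and scaleC_of_real: "complex_of_real r *\<^sub>C x = r *\<^sub>R x"
    and scaleC_mult_left: "(c *\<^sub>C x) * y = c *\<^sub>C (x * y)"
    and norm_scaleC: "norm (c *\<^sub>C x) = cmod c * norm x"
    and semisimple: "jacobson_radical = {0}"

definition character_space :: "('a::banach_function_algebra \<Rightarrow> complex) set" where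
  "character_space = {\<phi>. (\<forall>x y. \<phi> (x + y) = \<phi> x + \<phi> y) \<and> (\<forall>c x. \<phi> (c *\<^sub>C x) = c * \<phi> x) \<and>
     (\<forall>x y. \<phi> (x * y) = \<phi> x * \<phi> y) \<and> (\<exists>x. \<phi> x \<noteq> 0)}"

text \<open>
  The weak-* topology is the topology of pointwise convergence on the algebra, i.e. the
  one induced by the product topology on all functions from the algebra to the complex numbers.
\<close>

definition gelfand_topology :: "('a::banach_function_algebra \<Rightarrow> complex) topology" where
  "gelfand_topology = subtopology (product_topology (\<lambda>_. euclidean) UNIV) character_space"

definition gelfand_transform ::
    "'a::banach_function_algebra \<Rightarrow> ('a \<Rightarrow> complex) \<Rightarrow> complex" where
  "gelfand_transform f \<phi> = \<phi> f"

definition t_analytic :: "('a::banach_function_algebra \<Rightarrow> complex) set \<Rightarrow> bool" where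
  "t_analytic E \<longleftrightarrow> E \<subseteq> character_space \<and>
     (\<forall>f U. openin (subtopology gelfand_topology E) U \<and> U \<noteq> {} \<and>
        (\<forall>\<phi>\<in>U. gelfand_transform f \<phi> = 0) \<longrightarrow> (\<forall>\<phi>\<in>E. gelfand_transform f \<phi> = 0))"

definition maximal_t_analytic :: "('a::banach_function_algebra \<Rightarrow> complex) set \<Rightarrow> bool" where
  "maximal_t_analytic E \<longleftrightarrow>
     t_analytic E \<and> (\<forall>F. t_analytic F \<longrightarrow> E \<subseteq> F \<longrightarrow> F = E)"

end

theory Submission
  imports Defs
begin

text \<open>Being t-analytic survives two operations. First, unions of chains
  (\<open>t_analytic_Union_chain\<close>): the condition compares only a point of U with a point
  where f should vanish, and two points of the union of a chain already lie in one member. Second,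
  closure (\<open>t_analytic_closure\<close>): a non-empty relatively open subset of the closure
  meets the set itself, and zero sets are closed. Zorn's lemma turns the first fact into the
  existence of maximal sets; by the second, a maximal set must equal its own closure.\<close>

lemma topspace_gelfand_topology [simp]:
  "topspace gelfand_topology = (character_space :: ('a::banach_function_algebra \<Rightarrow> complex) set)"
  by (simp add: gelfand_topology_def)

text \<open>Evaluation at f is a coordinate projection of the product topology, hence continuous on
  the character space.\<close>

lemma closedin_zero_set:
  fixes f :: "'a::banach_function_algebra"
  shows "closedin gelfand_topology {\<phi> \<in> character_space. gelfand_transform f \<phi> = 0}"
proof -
  have "continuous_map gelfand_topology euclidean (gelfand_transform f)"
    unfolding gelfand_topology_def gelfand_transform_def
    by (intro continuous_map_from_subtopology continuous_map_product_projection) simp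
  from closedin_continuous_map_preimage[OF this, of "{0}"] show ?thesis
    by simp
qed

lemma t_analytic_subset: "t_analytic E \<Longrightarrow> E \<subseteq> character_space"
  by (simp add: t_analytic_def)

lemma t_analyticD:
  assumes "t_analytic E" "openin (subtopology gelfand_topology E) U" "U \<noteq> {}"
    "\<And>\<phi>. \<phi> \<in> U \<Longrightarrow> gelfand_transform f \<phi> = 0" "\<psi> \<in> E"
  shows "gelfand_transform f \<psi> = 0"
  using assms unfolding t_analytic_def by blast

lemma openin_subtopology_Int_subset:
  assumes "openin (subtopology X F) U" "E \<subseteq> F"
  shows "openin (subtopology X E) (U \<inter> E)"
  using assms by (auto simp: openin_subtopology)

text \<open>Given \<phi> in U and any \<psi> in the union, choose one member E of the chain
  containing both. The trace of U on E is relatively open and contains \<phi>, so f vanishes on E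
  and in particular at \<psi>.\<close>

lemma t_analytic_Union_chain:
  fixes \<C> :: "('a::banach_function_algebra \<Rightarrow> complex) set set"
  assumes chain: "subset.chain {E. t_analytic E} \<C>"
  shows "t_analytic (\<Union>\<C>)"
  unfolding t_analytic_def
proof (intro conjI allI impI ballI; (elim conjE)?)
  show "\<Union>\<C> \<subseteq> character_space"
    using chain t_analytic_subset by (fastforce simp: subset_chain_def)
next
  fix f U \<psi>
  assume U: "openin (subtopology gelfand_topology (\<Union>\<C>)) U" "U \<noteq> {}"
    and f: "\<forall>\<phi>\<in>U. gelfand_transform f \<phi> = 0" and "\<psi> \<in> \<Union>\<C>"
  from U obtain \<phi> where \<phi>: "\<phi> \<in> U" "\<phi> \<in> \<Union>\<C>"
    using openin_subset by fastforce
  from \<phi>(2) \<open>\<psi> \<in> \<Union>\<C>\<close> obtain D D' where D: "D \<in> \<C>" "\<phi> \<in> D" "D' \<in> \<C>" "\<psi> \<in> D'"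
    by blast
  with chain have "D \<subseteq> D' \<or> D' \<subseteq> D"
    by (auto simp: subset_chain_def)
  with D obtain E where E: "E \<in> \<C>" "\<phi> \<in> E" "\<psi> \<in> E"
    by blast
  show "gelfand_transform f \<psi> = 0"
  proof (rule t_analyticD)
    show "t_analytic E"
      using chain E by (auto simp: subset_chain_def)
    show "openin (subtopology gelfand_topology E) (U \<inter> E)"
      using U E by (intro openin_subtopology_Int_subset) auto
  qed (use \<phi> E f in auto)
qed

text \<open>Vanishing passes from U to its trace on E, from there to all of E by t-analyticity, and
  finally to the closure by continuity of the Gelfand transform.\<close>

lemma t_analytic_closure:
  assumes E: "t_analytic E"
  shows "t_analytic (gelfand_topology closure_of E)"
  unfolding t_analytic_def
proof (intro conjI allI impI ballI; (elim conjE)?)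
  let ?K = "gelfand_topology closure_of E"
  show "?K \<subseteq> character_space"
    using closure_of_subset_topspace[of gelfand_topology E] by simp
  fix f U \<psi>
  assume U: "openin (subtopology gelfand_topology ?K) U" "U \<noteq> {}"
    and f: "\<forall>\<phi>\<in>U. gelfand_transform f \<phi> = 0" and \<psi>: "\<psi> \<in> ?K"
  have sub: "E \<subseteq> ?K"
    using t_analytic_subset[OF E] by (simp add: closure_of_subset)
  from U(1) obtain T where T: "openin gelfand_topology T" "U = T \<inter> ?K"
    by (auto simp: openin_subtopology)
  \<comment> \<open>An open set that meets the closure of E meets E.\<close>
  have "T \<inter> E \<noteq> {}"
    using T U(2) openin_Int_closure_of_eq_empty by blast
  then have "U \<inter> E \<noteq> {}"
    using T sub by auto
  then have "gelfand_transform f \<phi> = 0" if "\<phi> \<in> E" for \<phi>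
    using t_analyticD[OF E openin_subtopology_Int_subset[OF U(1) sub]] f that by blast
  \<comment> \<open>The zero set of f is closed and contains E, so it contains the closure.\<close>
  then have "?K \<subseteq> {\<phi> \<in> character_space. gelfand_transform f \<phi> = 0}"
    using t_analytic_subset[OF E] by (intro closure_of_minimal closedin_zero_set) auto
  with \<psi> show "gelfand_transform f \<psi> = 0"
    by auto
qed

theorem theorem4p7:
  "(\<forall>E :: ('a::banach_function_algebra \<Rightarrow> complex) set.
       t_analytic E \<longrightarrow> (\<exists>F. maximal_t_analytic F \<and> E \<subseteq> F)) \<and>
   (\<forall>F :: ('a \<Rightarrow> complex) set.
       maximal_t_analytic F \<longrightarrow> closedin gelfand_topology F)"
proof (intro conjI allI impI)
  fix E :: "('a \<Rightarrow> complex) set"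
  assume E: "t_analytic E"
  let ?A = "{F. t_analytic F \<and> E \<subseteq> F}"
  have "\<exists>M\<in>?A. \<forall>F\<in>?A. M \<subseteq> F \<longrightarrow> F = M"
  \<comment> \<open>Zorn is applied only to t-analytic sets above E. Chains must be non-empty here,
    since the empty union need not contain E.\<close>
  proof (rule subset_Zorn_nonempty)
    show "?A \<noteq> {}"
      using E by auto
    fix \<C> assume nonempty: "\<C> \<noteq> {}" and \<C>: "subset.chain ?A \<C>"
    have "t_analytic (\<Union>\<C>)"
      using \<C> by (intro t_analytic_Union_chain) (auto simp: subset_chain_def)
    moreover have "E \<subseteq> C" if "C \<in> \<C>" for C
      using \<C> that by (auto simp: subset_chain_def)
    then have "E \<subseteq> \<Union>\<C>"
      using nonempty by (meson Union_upper ex_in_conv order_trans)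
    ultimately show "\<Union>\<C> \<in> ?A"
      by simp
  qed
  then obtain M where M: "t_analytic M" "E \<subseteq> M"
    and max: "\<And>F. t_analytic F \<Longrightarrow> E \<subseteq> F \<Longrightarrow> M \<subseteq> F \<Longrightarrow> F = M"
    by auto
  \<comment> \<open>Maximality above E is maximality outright: every set containing M contains
    E.\<close>
  have "maximal_t_analytic M"
    unfolding maximal_t_analytic_def using M max order_trans[OF M(2)] by simp
  with M show "\<exists>F. maximal_t_analytic F \<and> E \<subseteq> F"
    by auto
next
  fix F :: "('a \<Rightarrow> complex) set"
  assume F: "maximal_t_analytic F"
  then have "t_analytic F"
    by (simp add: maximal_t_analytic_def)
  then have "F \<subseteq> gelfand_topology closure_of F"
    by (simp add: closure_of_subset t_analytic_subset)
  \<comment> \<open>The closure is a t-analytic set containing F, so maximality forces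
    equality.\<close>
  with F \<open>t_analytic F\<close> have "gelfand_topology closure_of F = F"
    using t_analytic_closure unfolding maximal_t_analytic_def by blast
  then show "closedin gelfand_topology F"
    by (metis closedin_closure_of)
qed

end
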